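(* Let $d,\Delta,s$ be positive integers. There exist constants $\Lambda\in(0,1)$ and $c_0$, depending only on $d,\Delta,s$, such that the following holds. Let $X\subset\mathbb{R}^d$ be a finite set of $n$ points and $(X,\mathcal{R})$ a semi-algebraic set system generated by $\Gamma_{d,\Delta,s}$ with VC dimension $d_0$, such that $(X,\mathcal{R})$ and $(X,\mathcal{R}^{(c)})$ have shallow cell complexities $\psi(\cdot,\cdot)$ and $\psi'(\cdot,\cdot)$ respectively. Then for every $\varepsilon\in(0,1)$ there exists an $\varepsilon$-bracket $\mathcal{B}$ for $(X,\mathcal{R})$ with \[|\mathcal{B}|\le(c_0e)^{d_0}\left(\frac8\varepsilon\right)^{1+\frac{d_0}{\log(1-\Lambda/2)^{-1}}}\cdot\frac{96d_0}{\varepsilon^2}\left(\psi\!\left(\frac{8d_0}{\varepsilon^2},\frac{30d_0}{\varepsilon}\right)+\psi'\!\left(\frac{8d_0}{\varepsilon^2},\frac{30d_0}{\varepsilon}\right)\right),\] where $e$ is the base of the natural logarithm; $\Lambda,c_0$ are independent of $d_0,\varepsilon,n$.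
   Context: $\Gamma_{d,\Delta,s}$ is the class of subsets of $\mathbb{R}^d$ definable by a Boolean formula with at most $s$ Boolean operations (union, intersection, complement) applied to sets $\{x:f(x)\ge0\}$ with $f$ a $d$-variate real polynomial of degree at most $\Delta$; $(X,\mathcal{R})$ is generated by $\Gamma_{d,\Delta,s}$ if every $R\in\mathcal{R}$ equals $S\cap X$ for some $S\in\Gamma_{d,\Delta,s}$. $\mathcal{R}^{(c)}=\{X\setminus R:R\in\mathcal{R}\}$. A set system $(X,\mathcal{F})$ has shallow cell complexity $\psi$ if for every finite $Y\subseteq X$ and $\ell\le|Y|$, the number of sets of size at most $\ell$ in $\{F\cap Y:F\in\mathcal{F}\}$ is at most $|Y|\,\psi(|Y|,\ell)$. An $\varepsilon$-bracket for $(X,\mathcal{R})$ is a family $\mathcal{B}$ of subsets of $X$ such that for every $R\in\mathcal{R}$ there exist $B^-,B^+\in\mathcal{B}$ with $B^-\subseteq R\subseteq B^+$ and $|B^+\setminus B^-|\le\varepsilon|X|$.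
   Formalization: The formal version assumes d_0 ≥ 1 (for d_0 = 0 the bound is 0), takes ψ and ψ' nondecreasing in both arguments (otherwise they may vanish where the bound evaluates them), and requires the shallow cell condition only for nonempty Y. *)

theory Defs
  imports "HOL-Analysis.Analysis"
begin

text \<open>
  Points of $d$-space are vectors of type \<open>real ^ 'd\<close>, with \<open>CARD('d)\<close> as the dimension.
  A monomial in \<open>CARD('d)\<close> variables is given by its exponent function \<open>'d \<Rightarrow> nat\<close>.
\<close>

lemma finite_bounded_exponents: "finite {\<alpha> :: 'd::finite \<Rightarrow> nat. (\<Sum>i\<in>UNIV. \<alpha> i) \<le> \<Delta>}"
proof (rule finite_subset)
  show "{\<alpha> :: 'd \<Rightarrow> nat. (\<Sum>i\<in>UNIV. \<alpha> i) \<le> \<Delta>} \<subseteq> PiE UNIV (\<lambda>_. {..\<Delta>})"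
  proof
    fix \<alpha> :: "'d \<Rightarrow> nat"
    assume "\<alpha> \<in> {\<alpha>. (\<Sum>i\<in>UNIV. \<alpha> i) \<le> \<Delta>}"
    then have "\<alpha> i \<le> \<Delta>" for i
      using member_le_sum[of i UNIV \<alpha>] by (simp add: le_trans)
    then show "\<alpha> \<in> PiE UNIV (\<lambda>_. {..\<Delta>})" by auto
  qed
qed (simp add: finite_PiE)

definition polynomial_of_degree_le :: "nat \<Rightarrow> (real ^ 'd \<Rightarrow> real) \<Rightarrow> bool" where
  "polynomial_of_degree_le \<Delta> f \<longleftrightarrow>
     (\<exists>c :: ('d \<Rightarrow> nat) \<Rightarrow> real. \<forall>x.
        f x = (\<Sum>\<alpha> | (\<Sum>i\<in>UNIV. \<alpha> i) \<le> \<Delta>. c \<alpha> * (\<Prod>i\<in>UNIV. (x $ i) ^ \<alpha> i)))"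

datatype (atoms: 'a) bool_formula =
    Atom 'a
  | Cup "'a bool_formula" "'a bool_formula"
  | Cap "'a bool_formula" "'a bool_formula"
  | Cmpl "'a bool_formula"

primrec num_ops :: "'a bool_formula \<Rightarrow> nat" where
  "num_ops (Atom a) = 0"
| "num_ops (Cup \<phi> \<theta>) = Suc (num_ops \<phi> + num_ops \<theta>)"
| "num_ops (Cap \<phi> \<theta>) = Suc (num_ops \<phi> + num_ops \<theta>)"
| "num_ops (Cmpl \<phi>) = Suc (num_ops \<phi>)"

primrec defined_set :: "('a \<Rightarrow> real) bool_formula \<Rightarrow> 'a set" where
  "defined_set (Atom f) = {x. f x \<ge> 0}"
| "defined_set (Cup \<phi> \<theta>) = defined_set \<phi> \<union> defined_set \<theta>"
| "defined_set (Cap \<phi> \<theta>) = defined_set \<phi> \<inter> defined_set \<theta>"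
| "defined_set (Cmpl \<phi>) = - defined_set \<phi>"

definition semialgebraic_class :: "nat \<Rightarrow> nat \<Rightarrow> (real ^ 'd) set set" where
  "semialgebraic_class \<Delta> s =
     {defined_set \<phi> | \<phi>. num_ops \<phi> \<le> s \<and> (\<forall>f\<in>atoms \<phi>. polynomial_of_degree_le \<Delta> f)}"

definition generated_by :: "'a set \<Rightarrow> 'a set set \<Rightarrow> 'a set set \<Rightarrow> bool" where
  "generated_by X \<R> \<Gamma> \<longleftrightarrow> (\<forall>R\<in>\<R>. \<exists>S\<in>\<Gamma>. R = S \<inter> X)"

definition trace_on :: "'a set set \<Rightarrow> 'a set \<Rightarrow> 'a set set" where
  "trace_on \<F> Y = {F \<inter> Y | F. F \<in> \<F>}"

definition complement_system :: "'a set \<Rightarrow> 'a set set \<Rightarrow> 'a set set" where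
  "complement_system X \<R> = {X - R | R. R \<in> \<R>}"

definition shattered :: "'a set set \<Rightarrow> 'a set \<Rightarrow> bool" where
  "shattered \<F> Y \<longleftrightarrow> trace_on \<F> Y = Pow Y"

definition has_vc_dimension :: "'a set \<Rightarrow> 'a set set \<Rightarrow> nat \<Rightarrow> bool" where
  "has_vc_dimension X \<R> k \<longleftrightarrow>
     (\<exists>Y\<subseteq>X. finite Y \<and> shattered \<R> Y \<and> card Y = k) \<and>
     (\<forall>Y\<subseteq>X. finite Y \<and> shattered \<R> Y \<longrightarrow> card Y \<le> k)"

text \<open>
  The empty \<open>Y\<close> has to be excluded: its trace is \<open>{{}}\<close> as soon as the system is nonempty, while
  the bound \<open>card Y * \<psi> (card Y) l\<close> vanishes, so no \<open>\<psi>\<close> whatsoever would satisfy the condition.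
  The function \<open>\<psi>\<close> takes real arguments because it gets evaluated at non-integers.
\<close>

definition shallow_cell_complexity :: "'a set \<Rightarrow> 'a set set \<Rightarrow> (real \<Rightarrow> real \<Rightarrow> real) \<Rightarrow> bool" where
  "shallow_cell_complexity X \<F> \<psi> \<longleftrightarrow>
     (\<forall>Y\<subseteq>X. finite Y \<and> Y \<noteq> {} \<longrightarrow>
        (\<forall>l\<le>card Y. real (card {T \<in> trace_on \<F> Y. card T \<le> l})
                      \<le> real (card Y) * \<psi> (real (card Y)) (real l)))"

text \<open>
  The condition above constrains \<open>\<psi>\<close> only at integer points \<open>(m, l)\<close> with \<open>1 \<le> m \<le> card X\<close> and
  \<open>l \<le> m\<close>. Using a complexity function at other points, as bounds stated in terms of \<open>\<psi>\<close> do,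
  relies on the usual convention that it is nondecreasing.
\<close>

definition nondecreasing :: "(real \<Rightarrow> real \<Rightarrow> real) \<Rightarrow> bool" where
  "nondecreasing \<psi> \<longleftrightarrow>
     (\<forall>m m' l l'. 1 \<le> m \<and> m \<le> m' \<and> 0 \<le> l \<and> l \<le> l' \<longrightarrow> \<psi> m l \<le> \<psi> m' l')"

definition is_bracket :: "real \<Rightarrow> 'a set \<Rightarrow> 'a set set \<Rightarrow> 'a set set \<Rightarrow> bool" where
  "is_bracket \<epsilon> X \<R> \<B> \<longleftrightarrow>
     \<B> \<subseteq> Pow X \<and>
     (\<forall>R\<in>\<R>. \<exists>L\<in>\<B>. \<exists>U\<in>\<B>. L \<subseteq> R \<and> R \<subseteq> U \<and>
        real (card (U - L)) \<le> \<epsilon> * real (card X))"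

end

theory Submission
  imports Defs
begin

text \<open>
  Taking \<open>\<Lambda>\<close> small makes the exponent of \<open>8 / \<epsilon>\<close> as large as desired, and a system that shatters a
  point has \<open>\<psi>\<close> and \<open>\<psi>'\<close> at least 1, so brackets of size \<open>C (1 / \<epsilon>)\<^sup>E\<close> with constants
  depending only on the class suffice. Boolean operations preserve the existence of such brackets, which
  leaves the sets \<open>{x. f x \<ge> 0}\<close>. Dually, a point \<open>x\<close> is a linear form on the space of coefficient
  vectors of \<open>f\<close>. By Megiddo's pairing argument this space is covered by boundedly many cells, on each
  of which a fixed fraction of a given family of forms has constant sign. After iterating on the
  remaining forms, every cell leaves at most \<open>\<epsilon> |X|\<close> points undecided, and each cell gives one
  bracketing pair.
\<close>

section \<open>Constant signs on cells and spans of linear forms\<close>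

text \<open>Zero is a sign of its own, so the sign of a single form splits the space into three
  cells. On an empty cell the condition holds vacuously, so cells that become empty under
  intersection do no harm.\<close>

definition const_sign :: "'c set \<Rightarrow> ('c \<Rightarrow> real) \<Rightarrow> bool" where
  "const_sign S f \<longleftrightarrow> (\<forall>x\<in>S. \<forall>y\<in>S. sgn (f x) = sgn (f y))"

text \<open>The generators form a list, so that an induction on the dimension is an induction on its
  length and the coefficient of the head can be split off. They may be linearly dependent: the
  length is an upper bound for the dimension.\<close>

primrec lin_span :: "('c \<Rightarrow> real) list \<Rightarrow> ('c \<Rightarrow> real) set" where
  "lin_span [] = {\<lambda>_. 0}"
| "lin_span (g # G) = {\<lambda>x. a * g x + f x | a f. f \<in> lin_span G}"

lemma lin_span_ConsI: "f \<in> lin_span G \<Longrightarrow> (\<And>x. h x = a * g x + f x) \<Longrightarrow> h \<in> lin_span (g # G)"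
  unfolding lin_span.simps by (rule CollectI, rule exI[of _ a], rule exI[of _ f]) auto

lemma lin_span_combine:
  "f \<in> lin_span G \<Longrightarrow> g \<in> lin_span G \<Longrightarrow> (\<lambda>x. p * f x + q * g x) \<in> lin_span G"
proof (induction G arbitrary: f g)
  case (Cons k G)
  then obtain a f' b g' where *: "f' \<in> lin_span G" "g' \<in> lin_span G"
    "f = (\<lambda>x. a * k x + f' x)" "g = (\<lambda>x. b * k x + g' x)"
    unfolding lin_span.simps by blast
  show ?case
    by (rule lin_span_ConsI[OF Cons.IH[OF *(1,2)], of _ "p * a + q * b"])
       (simp add: * algebra_simps)
qed simp

lemma lin_span_scale: "f \<in> lin_span G \<Longrightarrow> (\<lambda>x. p * f x) \<in> lin_span G"
  using lin_span_combine[of f G f p 0] by simp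

lemma sum_in_lin_span:
  "(\<lambda>x. \<Sum>k\<leftarrow>ks. a k * g k x) \<in> lin_span (map g ks)"
proof (induction ks)
  case (Cons k ks)
  show ?case by (simp only: list.map, rule lin_span_ConsI[OF Cons.IH, of _ "a k"]) simp
qed simp

lemma const_sign_subset: "const_sign S f \<Longrightarrow> T \<subseteq> S \<Longrightarrow> const_sign T f"
  by (auto simp: const_sign_def)

lemma const_sign_mult_iff: "a \<noteq> 0 \<Longrightarrow> const_sign S (\<lambda>x. a * f x) \<longleftrightarrow> const_sign S f"
  by (simp add: const_sign_def sgn_mult sgn_zero_iff)

lemma const_signI:
  assumes "(\<forall>x\<in>S. f x > 0) \<or> (\<forall>x\<in>S. f x < 0) \<or> (\<forall>x\<in>S. f x = 0)"
  shows "const_sign S f"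
  using assms by (auto simp: const_sign_def)

lemma const_signD:
  assumes "const_sign S f"
  shows "(\<forall>x\<in>S. f x > 0) \<or> (\<forall>x\<in>S. f x < 0) \<or> (\<forall>x\<in>S. f x = 0)"
proof (cases "S = {}")
  case False
  then obtain z where "z \<in> S" by blast
  then have eq: "sgn (f x) = sgn (f z)" if "x \<in> S" for x
    using assms that \<open>z \<in> S\<close> unfolding const_sign_def by blast
  have pos: "0 < f x \<longleftrightarrow> 0 < f z" if "x \<in> S" for x
    using eq[OF that] by (metis sgn_greater)
  have neg: "f x < 0 \<longleftrightarrow> f z < 0" if "x \<in> S" for x
    using eq[OF that] by (metis sgn_less)
  consider "0 < f z" | "f z < 0" | "f z = 0" by linarith
  then show ?thesis
  proof cases
    case 3
    have "f x = 0" if "x \<in> S" for x using pos[OF that] neg[OF that] 3 by linarith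
    then show ?thesis by blast
  qed (use pos neg in blast)+
qed simp

text \<open>Two queries settle one of two forms: \<open>f - g\<close> tells which of the two is the larger one, and
  the sign of a positive combination is passed on to the larger or to the smaller one.\<close>

lemma const_sign_pair:
  fixes p q :: real
  assumes pq: "p \<ge> 0" "q \<ge> 0" "p + q > 0"
    and comb: "const_sign S (\<lambda>x. p * f x + q * g x)"
    and diff: "const_sign S (\<lambda>x. f x - g x)"
  shows "const_sign S f \<or> const_sign S g"
proof -
  \<comment> \<open>The combination lies between \<open>p + q\<close> times the smaller and
    \<open>p + q\<close> times the larger of the two values.\<close>
  have bound: "p * a + q * b \<le> (p + q) * a" "(p + q) * b \<le> p * a + q * b" if "b \<le> a" for a b
    using mult_left_mono[OF that pq(2)] mult_left_mono[OF that pq(1)] by (auto simp: algebra_simps)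
  have bound': "p * a + q * b \<le> (p + q) * b" "(p + q) * a \<le> p * a + q * b" if "a \<le> b" for a b
    using mult_left_mono[OF that pq(2)] mult_left_mono[OF that pq(1)] by (auto simp: algebra_simps)
  have pos: "a > 0" if "(p + q) * a > 0" for a
    using that pq by (simp add: zero_less_mult_iff)
  have neg: "a < 0" if "(p + q) * a < 0" for a
    using that pq by (simp add: mult_less_0_iff)
  have compare: "(\<forall>x\<in>S. g x \<le> f x) \<or> (\<forall>x\<in>S. f x \<le> g x)"
    using const_signD[OF diff] by auto
  consider (P) "\<forall>x\<in>S. p * f x + q * g x > 0" | (N) "\<forall>x\<in>S. p * f x + q * g x < 0"
    | (Z) "\<forall>x\<in>S. p * f x + q * g x = 0"
    using const_signD[OF comb] by blast
  then show ?thesis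
  proof cases
    case P
    have "f x > 0" if "x \<in> S" "g x \<le> f x" for x
      by (rule pos[OF less_le_trans[OF bspec[OF P that(1)] bound(1)[OF that(2)]]])
    moreover have "g x > 0" if "x \<in> S" "f x \<le> g x" for x
      by (rule pos[OF less_le_trans[OF bspec[OF P that(1)] bound'(1)[OF that(2)]]])
    ultimately have "(\<forall>x\<in>S. f x > 0) \<or> (\<forall>x\<in>S. g x > 0)"
      using compare by blast
    then show ?thesis by (blast intro: const_signI)
  next
    case N
    have "g x < 0" if "x \<in> S" "g x \<le> f x" for x
      by (rule neg[OF le_less_trans[OF bound(2)[OF that(2)] bspec[OF N that(1)]]])
    moreover have "f x < 0" if "x \<in> S" "f x \<le> g x" for x
      by (rule neg[OF le_less_trans[OF bound'(2)[OF that(2)] bspec[OF N that(1)]]])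
    ultimately have "(\<forall>x\<in>S. f x < 0) \<or> (\<forall>x\<in>S. g x < 0)"
      using compare by blast
    then show ?thesis by (blast intro: const_signI)
  next
    case Z
    have cases0: "p = 0 \<or> q = 0 \<or> p > 0 \<and> q > 0" using pq by auto
    then show ?thesis
    proof (elim disjE conjE)
      assume "p = 0"
      then have "\<forall>x\<in>S. g x = 0" using Z pq by auto
      then show ?thesis by (blast intro: const_signI)
    next
      assume "q = 0"
      then have "\<forall>x\<in>S. f x = 0" using Z pq by auto
      then show ?thesis by (blast intro: const_signI)
    next
      assume p: "p > 0" "q > 0"
      \<comment> \<open>Where the combination vanishes, \<open>f\<close> is a positive multiple of
        \<open>f - g\<close>, so the sign of the difference is the sign of \<open>f\<close>.\<close>
      have eq: "(p + q) * f x = q * (f x - g x)" if "x \<in> S" for x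
        using Z that by (simp add: algebra_simps)
      have "sgn (f x) = sgn (f x - g x)" if "x \<in> S" for x
      proof -
        have "sgn (p + q) * sgn (f x) = sgn q * sgn (f x - g x)"
          by (simp only: sgn_mult[symmetric] eq[OF that])
        then show ?thesis using p by (simp only: sgn_pos add_pos_pos mult_1)
      qed
      then have "const_sign S f" using diff unfolding const_sign_def by metis
      then show ?thesis ..
    qed
  qed
qed

section \<open>Medians, covers by cells, and Megiddo's pairing step\<close>

text \<open>Take for \<open>\<beta>\<close> the least value of \<open>b\<close> that has at least
  half of the indices at or below it. The next smaller value \<open>v\<close> fails this test, so
  fewer than half of the indices lie strictly below \<open>\<beta>\<close>.\<close>

lemma median_exists:
  fixes b :: "'i \<Rightarrow> real"
  assumes "finite I" "I \<noteq> {}"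
  obtains \<beta> where "card I \<le> 2 * card {i\<in>I. b i \<le> \<beta>}" "card I \<le> 2 * card {i\<in>I. \<beta> \<le> b i}"
proof -
  let ?V = "{v \<in> b ` I. card I \<le> 2 * card {i\<in>I. b i \<le> v}}"
  define \<beta> where "\<beta> = Min ?V"
  have "{i\<in>I. b i \<le> Max (b ` I)} = I" using assms by auto
  moreover have "Max (b ` I) \<in> b ` I" using assms by (intro Max_in) auto
  ultimately have "Max (b ` I) \<in> ?V" by simp
  then have ne: "?V \<noteq> {}" by blast
  have fin: "finite ?V" using assms by simp
  have mem: "\<beta> \<in> ?V" unfolding \<beta>_def using fin ne by (rule Min_in)
  have "card I \<le> 2 * card {i\<in>I. \<beta> \<le> b i}"
  proof (cases "{i\<in>I. b i < \<beta>} = {}")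
    case True
    then have "{i\<in>I. \<beta> \<le> b i} = I" by (auto simp: not_less)
    then show ?thesis by simp
  next
    case False
    let ?W = "b ` {i\<in>I. b i < \<beta>}"
    define v where "v = Max ?W"
    have W: "finite ?W" "?W \<noteq> {}" using False assms by auto
    have v: "v \<in> ?W" unfolding v_def using W by (rule Max_in)
    have "b i \<le> v \<longleftrightarrow> b i < \<beta>" if "i \<in> I" for i
      using v Max_ge[OF W(1), of "b i"] that by (auto simp: v_def)
    then have eq: "{i\<in>I. b i \<le> v} = {i\<in>I. b i < \<beta>}" by auto
    have "v \<notin> ?V"
      using v Min_le[OF fin, of v] by (auto simp: \<beta>_def)
    then have lt: "2 * card {i\<in>I. b i < \<beta>} < card I" using v eq by auto
    have "{i\<in>I. b i < \<beta>} \<union> {i\<in>I. \<beta> \<le> b i} = I" by auto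
    moreover have "card ({i\<in>I. b i < \<beta>} \<union> {i\<in>I. \<beta> \<le> b i})
        = card {i\<in>I. b i < \<beta>} + card {i\<in>I. \<beta> \<le> b i}"
      using assms by (intro card_Un_disjoint) auto
    ultimately show ?thesis using lt by simp
  qed
  then show thesis using mem that by auto
qed

text \<open>The cells may overlap. The parameter \<open>\<mu>\<close> is an absolute number of forms
  and not a fraction, so that a cover for a subfamily also serves the whole family.\<close>

definition sign_cover :: "nat \<Rightarrow> real \<Rightarrow> 'i set \<Rightarrow> ('i \<Rightarrow> 'c \<Rightarrow> real) \<Rightarrow> 'c set set \<Rightarrow> bool" where
  "sign_cover K \<mu> I l \<C> \<longleftrightarrow> finite \<C> \<and> card \<C> \<le> K \<and> \<Union>\<C> = UNIV \<and>
     (\<forall>\<sigma>\<in>\<C>. \<mu> \<le> real (card {i\<in>I. const_sign \<sigma> (l i)}))"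

text \<open>Each cell is cut by a cover of its own, and the pieces
  \<open>\<sigma> \<inter> \<tau>\<close> again cover everything. Since the second cover may depend
  on \<open>\<sigma>\<close>, the next queries can be aimed at the forms that matter in that
  cell.\<close>

lemma refine_cover:
  assumes "finite \<C>" "card \<C> \<le> K" "\<Union>\<C> = UNIV"
    and ref: "\<And>\<sigma>. \<sigma> \<in> \<C> \<Longrightarrow> \<exists>\<D>. finite \<D> \<and> card \<D> \<le> M \<and> \<Union>\<D> = UNIV \<and> (\<forall>\<tau>\<in>\<D>. P (\<sigma> \<inter> \<tau>))"
  shows "\<exists>\<E>. finite \<E> \<and> card \<E> \<le> K * M \<and> \<Union>\<E> = UNIV \<and> (\<forall>\<rho>\<in>\<E>. P \<rho>)"
proof -
  have "\<forall>\<sigma>\<in>\<C>. \<exists>\<D>. finite \<D> \<and> card \<D> \<le> M \<and> \<Union>\<D> = UNIV \<and> (\<forall>\<tau>\<in>\<D>. P (\<sigma> \<inter> \<tau>))"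
    using ref by blast
  then obtain \<D> where "\<forall>\<sigma>\<in>\<C>. finite (\<D> \<sigma>) \<and> card (\<D> \<sigma>) \<le> M \<and> \<Union>(\<D> \<sigma>) = UNIV \<and>
      (\<forall>\<tau>\<in>\<D> \<sigma>. P (\<sigma> \<inter> \<tau>))"
    by (elim bchoice[THEN exE])
  then have \<D>: "finite (\<D> \<sigma>)" "card (\<D> \<sigma>) \<le> M" "\<Union>(\<D> \<sigma>) = UNIV"
    "\<And>\<tau>. \<tau> \<in> \<D> \<sigma> \<Longrightarrow> P (\<sigma> \<inter> \<tau>)" if "\<sigma> \<in> \<C>" for \<sigma>
    using that by simp_all
  define \<E> where "\<E> = (\<Union>\<sigma>\<in>\<C>. (\<inter>) \<sigma> ` \<D> \<sigma>)"
  have "card \<E> \<le> (\<Sum>\<sigma>\<in>\<C>. card ((\<inter>) \<sigma> ` \<D> \<sigma>))"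
    unfolding \<E>_def by (rule card_UN_le) fact
  also have "\<dots> \<le> (\<Sum>\<sigma>\<in>\<C>. M)"
    by (intro sum_mono order_trans[OF card_image_le]) (simp_all add: \<D>)
  also have "\<dots> \<le> K * M" using assms(2) by simp
  finally have card: "card \<E> \<le> K * M" .
  have fin: "finite \<E>" unfolding \<E>_def by (intro finite_UN_I finite_imageI assms(1) \<D>(1))
  have cover: "\<exists>\<rho>\<in>\<E>. x \<in> \<rho>" for x
  proof -
    obtain \<sigma> where s: "\<sigma> \<in> \<C>" "x \<in> \<sigma>" using UNIV_I[of x] assms(3) by (metis UnionE)
    then obtain \<tau> where "\<tau> \<in> \<D> \<sigma>" "x \<in> \<tau>" using UNIV_I[of x] \<D>(3) by (metis UnionE)
    then show ?thesis using s by (auto simp: \<E>_def)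
  qed
  have "P \<rho>" if "\<rho> \<in> \<E>" for \<rho> using that \<D>(4) by (auto simp: \<E>_def)
  then show ?thesis using card fin cover by (intro exI[of _ \<E>]) auto
qed

text \<open>All forms are multiples of \<open>g\<close>, so the three cells given by the sign of
  \<open>g\<close> settle every one of them.\<close>

lemma sign_cover_exists_one:
  fixes l :: "'i \<Rightarrow> 'c \<Rightarrow> real"
  assumes "\<forall>i\<in>I. l i \<in> lin_span [g]"
  shows "\<exists>\<C>. sign_cover 3 (1 * real (card I)) I l \<C>"
proof -
  define \<C> where "\<C> = {{x. g x > 0}, {x. g x < 0}, {x. g x = 0}}"
  have const: "const_sign \<sigma> (l i)" if i: "i \<in> I" and \<sigma>: "\<sigma> \<in> \<C>" for i \<sigma>
  proof -
    have "l i \<in> lin_span [g]" using assms i by blast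
    then obtain a where a: "l i = (\<lambda>x. a * g x)" by auto
    have "const_sign \<sigma> g" using \<sigma> by (intro const_signI) (auto simp: \<C>_def)
    then show ?thesis unfolding a const_sign_def sgn_mult by metis
  qed
  have "1 * real (card I) \<le> real (card {i\<in>I. const_sign \<sigma> (l i)})" if "\<sigma> \<in> \<C>" for \<sigma>
  proof -
    have "{i\<in>I. const_sign \<sigma> (l i)} = I" using const that by blast
    then show ?thesis by simp
  qed
  moreover have "\<Union>\<C> = UNIV" by (auto simp: \<C>_def)
  moreover have "card \<C> \<le> 3" "finite \<C>" by (auto simp: \<C>_def card_insert_if)
  ultimately show ?thesis unfolding sign_cover_def by blast
qed

lemma sign_cover_mono:
  assumes "sign_cover K \<mu> J l \<C>" "K \<le> K'" "\<mu>' \<le> \<mu>" "J \<subseteq> I" "finite I"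
  shows "sign_cover K' \<mu>' I l \<C>"
proof -
  have "card {i\<in>J. const_sign \<sigma> (l i)} \<le> card {i\<in>I. const_sign \<sigma> (l i)}" for \<sigma>
    using assms by (intro card_mono) auto
  then have "\<mu>' \<le> real (card {i\<in>I. const_sign \<sigma> (l i)})" if "\<sigma> \<in> \<C>" for \<sigma>
    using assms(1,3) that unfolding sign_cover_def by (meson of_nat_mono order.trans)
  then show ?thesis using assms(1,2) unfolding sign_cover_def by auto
qed

text \<open>\<open>K\<close> and \<open>\<mu>\<close> are uniform over all generators and all
  families. The type arguments are there because the types of indices and of points otherwise occur
  in bound variables only.\<close>

definition covers_dim :: "'i itself \<Rightarrow> 'c itself \<Rightarrow> nat \<Rightarrow> nat \<Rightarrow> real \<Rightarrow> bool" where
  "covers_dim _ _ D K \<mu> \<longleftrightarrow> (\<forall>(G :: ('c \<Rightarrow> real) list) (I :: 'i set) l.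
     length G = D \<longrightarrow> finite I \<longrightarrow> (\<forall>i\<in>I. l i \<in> lin_span G) \<longrightarrow>
     (\<exists>\<C>. sign_cover K (\<mu> * real (card I)) I l \<C>))"

lemma covers_dimD:
  fixes G :: "('c \<Rightarrow> real) list" and I :: "'i set"
  assumes "covers_dim TYPE('i) TYPE('c) D K \<mu>" "length G = D" "finite I"
    "\<And>i. i \<in> I \<Longrightarrow> l i \<in> lin_span G"
  shows "\<exists>\<C>. sign_cover K (\<mu> * real (card I)) I l \<C>"
  using assms unfolding covers_dim_def by blast

text \<open>A form whose coefficient \<open>b\<close> is at most the median \<open>\<beta>\<close> is paired with one whose coefficient
  is at least \<open>\<beta>\<close>. Some nonnegative combination of the two lies in the span of
  \<open>g\<^sub>1 + \<beta> g\<^sub>2\<close> and \<open>G\<close>, and their difference in that of \<open>g\<^sub>2\<close> and \<open>G\<close>: one dimension less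
  in both cases. A form may occur in two pairs, which costs a factor of 2.\<close>

lemma sign_cover_pairing:
  fixes g\<^sub>1 g\<^sub>2 :: "'c \<Rightarrow> real" and b :: "'i \<Rightarrow> real"
  assumes cov: "covers_dim TYPE('i) TYPE('c) (Suc (length G)) K \<mu>" and \<mu>: "0 < \<mu>"
    and I: "finite I" and f: "\<And>i. i \<in> I \<Longrightarrow> f i \<in> lin_span G"
    and l: "\<And>i x. i \<in> I \<Longrightarrow> l i x = g\<^sub>1 x + b i * g\<^sub>2 x + f i x"
  shows "\<exists>\<C>. sign_cover (K * K) (\<mu>\<^sup>2 / 4 * real (card I)) I l \<C>"
proof (cases "I = {}")
  case True
  then have "sign_cover 1 0 I l {UNIV}" by (simp add: sign_cover_def)
  \<comment> \<open>An empty family has no median. Here one cell suffices, and the hypothesis for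
    the empty family yields \<open>K \<ge> 1\<close>, because a cover of a nonempty space has a
    cell.\<close>
  moreover have "K \<ge> 1"
  proof -
    have "\<exists>\<C>. sign_cover K (\<mu> * real (card ({} :: 'i set))) {} l \<C>"
      by (rule covers_dimD[OF cov, of "g\<^sub>1 # G"]) simp_all
    then obtain \<C> where "sign_cover K (\<mu> * real (card ({} :: 'i set))) {} l \<C>" ..
    then have "finite \<C>" "card \<C> \<le> K" "\<C> \<noteq> {}" by (auto simp: sign_cover_def)
    then have "0 < card \<C>" by (simp add: card_gt_0_iff)
    then show ?thesis using \<open>card \<C> \<le> K\<close> by linarith
  qed
  ultimately show ?thesis using True unfolding sign_cover_def
    by (intro exI[of _ "{UNIV}"]) auto
next
  case False
  obtain \<beta> where \<beta>: "card I \<le> 2 * card {i\<in>I. b i \<le> \<beta>}" "card I \<le> 2 * card {i\<in>I. \<beta> \<le> b i}"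
    using median_exists[OF I False] by blast
  \<comment> \<open>Half of the family, rounded up: both sides of the median have at least that many
    members. Equal sizes of \<open>A\<close> and \<open>B\<close> permit a bijection, and the two
    sets may overlap.\<close>
  define h where "h = (card I + 1) div 2"
  have "h \<le> card {i\<in>I. b i \<le> \<beta>}" "h \<le> card {i\<in>I. \<beta> \<le> b i}"
    using \<beta> by (auto simp: h_def)
  then obtain A B where A: "A \<subseteq> {i\<in>I. b i \<le> \<beta>}" "card A = h"
    and B: "B \<subseteq> {i\<in>I. \<beta> \<le> b i}" "card B = h"
    by (meson obtain_subset_with_card_n)
  have fin: "finite A" "finite B" using A B I by (auto intro: finite_subset)
  then obtain \<pi> where \<pi>: "bij_betw \<pi> A B"
    using A B finite_same_card_bij by metis
  have AB: "i \<in> I" "\<pi> i \<in> I" "b i \<le> \<beta>" "\<beta> \<le> b (\<pi> i)" if "i \<in> A" for i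
    using that A B bij_betwE[OF \<pi>] by auto
  \<comment> \<open>The weights are the distances of the two coefficients from
    \<open>\<beta>\<close>, exchanged, so that their weighted mean is \<open>\<beta>\<close>. Both
    distances vanish only if both coefficients equal \<open>\<beta>\<close>; then any weights work,
    and 1 keeps their sum positive.\<close>
  define p where "p i = (if b i = \<beta> \<and> b (\<pi> i) = \<beta> then 1 else b (\<pi> i) - \<beta>)" for i
  define q where "q i = (if b i = \<beta> \<and> b (\<pi> i) = \<beta> then 1 else \<beta> - b i)" for i
  have pq: "p i \<ge> 0" "q i \<ge> 0" "p i + q i > 0" if "i \<in> A" for i
    using AB[OF that] by (auto simp: p_def q_def)
  have elim: "p i * (b i - \<beta>) + q i * (b (\<pi> i) - \<beta>) = 0" for i
    by (auto simp: p_def q_def algebra_simps)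
  define u where "u i = (\<lambda>x. p i * l i x + q i * l (\<pi> i) x)" for i
  define w where "w i = (\<lambda>x. l i x - l (\<pi> i) x)" for i
  have u: "u i \<in> lin_span ((\<lambda>x. g\<^sub>1 x + \<beta> * g\<^sub>2 x) # G)" if "i \<in> A" for i
  proof (rule lin_span_ConsI[OF lin_span_combine[OF f f]])
    show "i \<in> I" "\<pi> i \<in> I" using AB that by auto
    show "u i x = (p i + q i) * (g\<^sub>1 x + \<beta> * g\<^sub>2 x) + (p i * f i x + q i * f (\<pi> i) x)" for x
    proof -
      have "u i x = (p i + q i) * (g\<^sub>1 x + \<beta> * g\<^sub>2 x) + (p i * f i x + q i * f (\<pi> i) x)
           + (p i * (b i - \<beta>) + q i * (b (\<pi> i) - \<beta>)) * g\<^sub>2 x"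
        using AB that by (simp add: u_def l algebra_simps)
      then show ?thesis by (simp add: elim)
    qed
  qed
  have w: "w i \<in> lin_span (g\<^sub>2 # G)" if "i \<in> A" for i
  proof (rule lin_span_ConsI[OF lin_span_combine[OF f f]])
    show "i \<in> I" "\<pi> i \<in> I" using AB that by auto
    show "w i x = (b i - b (\<pi> i)) * g\<^sub>2 x + (1 * f i x + (-1) * f (\<pi> i) x)" for x
      using AB that by (simp add: w_def l algebra_simps)
  qed
  have "\<exists>\<C>. sign_cover K (\<mu> * real (card A)) A u \<C>"
    by (rule covers_dimD[OF cov _ fin(1) u]) simp_all
  then obtain \<C> where \<C>: "sign_cover K (\<mu> * real (card A)) A u \<C>" ..
  have half: "real (card I) / 2 \<le> real (card A)" using A by (simp add: h_def)
  have "\<exists>\<E>. finite \<E> \<and> card \<E> \<le> K * K \<and> \<Union>\<E> = UNIV \<and>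
      (\<forall>\<rho>\<in>\<E>. \<mu>\<^sup>2 / 4 * real (card I) \<le> real (card {i\<in>I. const_sign \<rho> (l i)}))"
  proof (rule refine_cover)
    show "finite \<C>" "card \<C> \<le> K" "\<Union>\<C> = UNIV" using \<C> by (auto simp: sign_cover_def)
    fix \<sigma> assume "\<sigma> \<in> \<C>"
    define A' where "A' = {i\<in>A. const_sign \<sigma> (u i)}"
    have A': "\<mu> * real (card A) \<le> real (card A')" "finite A'"
      using \<C> \<open>\<sigma> \<in> \<C>\<close> fin by (auto simp: sign_cover_def A'_def)
    \<comment> \<open>The second round of queries is adapted to \<open>\<sigma>\<close>: it concerns
      the differences of those pairs whose combination is already settled there.\<close>
    have "\<exists>\<D>. sign_cover K (\<mu> * real (card A')) A' w \<D>"
      by (rule covers_dimD[OF cov _ A'(2) w]) (simp_all add: A'_def)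
    then obtain \<D> where \<D>: "sign_cover K (\<mu> * real (card A')) A' w \<D>" ..
    have "\<mu>\<^sup>2 / 4 * real (card I) \<le> real (card {i\<in>I. const_sign (\<sigma> \<inter> \<tau>) (l i)})"
      if "\<tau> \<in> \<D>" for \<tau>
    proof -
      let ?R = "{i\<in>I. const_sign (\<sigma> \<inter> \<tau>) (l i)}"
      define T where "T = {i\<in>A'. const_sign \<tau> (w i)}"
      have T: "\<mu> * real (card A') \<le> real (card T)"
        using \<D> that by (simp add: sign_cover_def T_def)
      have TA: "T \<subseteq> A" by (auto simp: T_def A'_def)
      \<comment> \<open>Every pair in \<open>T\<close> has a settled member. \<open>T1\<close>
        collects the pairs where it is the first one, \<open>T2\<close> those where it is the second
        one; each embeds into the set of settled forms.\<close>
      define T1 where "T1 = {i\<in>T. const_sign (\<sigma> \<inter> \<tau>) (l i)}"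
      define T2 where "T2 = {i\<in>T. const_sign (\<sigma> \<inter> \<tau>) (l (\<pi> i))}"
      have "const_sign (\<sigma> \<inter> \<tau>) (l i) \<or> const_sign (\<sigma> \<inter> \<tau>) (l (\<pi> i))" if "i \<in> T" for i
      proof (rule const_sign_pair)
        show "0 \<le> p i" "0 \<le> q i" "0 < p i + q i" using pq that TA by auto
        show "const_sign (\<sigma> \<inter> \<tau>) (\<lambda>x. p i * l i x + q i * l (\<pi> i) x)"
          using that const_sign_subset[of \<sigma> "u i" "\<sigma> \<inter> \<tau>"] by (auto simp: T_def A'_def u_def)
        show "const_sign (\<sigma> \<inter> \<tau>) (\<lambda>x. l i x - l (\<pi> i) x)"
          using that const_sign_subset[of \<tau> "w i" "\<sigma> \<inter> \<tau>"] by (auto simp: T_def w_def)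
      qed
      then have "T = T1 \<union> T2" by (auto simp: T1_def T2_def)
      then have "card T \<le> card T1 + card T2" by (simp add: card_Un_le)
      moreover have "card T1 \<le> card ?R"
        using TA AB I by (intro card_mono) (auto simp: T1_def)
      moreover have "card T2 \<le> card ?R"
      proof -
        have "inj_on \<pi> T2"
          using bij_betw_imp_inj_on[OF \<pi>] by (rule inj_on_subset) (use TA in \<open>auto simp: T2_def\<close>)
        moreover have "\<pi> ` T2 \<subseteq> ?R" using TA AB by (auto simp: T2_def)
        ultimately show ?thesis by (rule card_inj_on_le) (use I in simp)
      qed
      ultimately have "real (card T) \<le> 2 * real (card ?R)" by linarith
      \<comment> \<open>There are at least \<open>card I / 2\<close> pairs, and each of the two
        rounds keeps a fraction \<open>\<mu>\<close> of them. Together with the factor 2 for double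
        counting this gives \<open>\<mu>\<^sup>2 / 4\<close>.\<close>
      moreover have "\<mu> * (\<mu> * (real (card I) / 2)) \<le> real (card T)"
      proof -
        have "\<mu> * (real (card I) / 2) \<le> \<mu> * real (card A)"
          using half \<mu> by (intro mult_left_mono) auto
        then have "\<mu> * (real (card I) / 2) \<le> real (card A')" using A'(1) by linarith
        then have "\<mu> * (\<mu> * (real (card I) / 2)) \<le> \<mu> * real (card A')"
          using \<mu> by (intro mult_left_mono) auto
        then show ?thesis using T by linarith
      qed
      ultimately show ?thesis by (simp add: power2_eq_square)
    qed
    then show "\<exists>\<D>. finite \<D> \<and> card \<D> \<le> K \<and> \<Union>\<D> = UNIV \<and> (\<forall>\<tau>\<in>\<D>. \<mu>\<^sup>2 / 4 * real (card I)
        \<le> real (card {i\<in>I. const_sign (\<sigma> \<inter> \<tau>) (l i)}))"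
      using \<D> unfolding sign_cover_def by blast
  qed
  then show ?thesis by (simp add: sign_cover_def)
qed

text \<open>Pairing wants coefficient 1 at \<open>g\<^sub>1\<close>. Forms with
  \<open>a i \<noteq> 0\<close> are divided by \<open>a i\<close>, which may flip signs but
  preserves their constancy; forms with \<open>a i = 0\<close> already live in one dimension less.
  The larger class has at least half of the forms, which turns 4 into 8.\<close>

lemma covers_dim_step:
  assumes cov: "covers_dim TYPE('i) TYPE('c) (Suc D) K \<mu>" and \<mu>: "0 < \<mu>" "\<mu> \<le> 1"
  shows "covers_dim TYPE('i) TYPE('c) (Suc (Suc D)) (K * K) (\<mu>\<^sup>2 / 8)"
  unfolding covers_dim_def
proof (intro allI impI)
  fix G' :: "('c \<Rightarrow> real) list" and I :: "'i set" and l
  assume len: "length G' = Suc (Suc D)" and I: "finite I" and l: "\<forall>i\<in>I. l i \<in> lin_span G'"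
  then obtain g\<^sub>1 g\<^sub>2 G where G': "G' = g\<^sub>1 # g\<^sub>2 # G" "length G = D"
    by (metis length_Suc_conv)
  have "\<exists>a b f. f \<in> lin_span G \<and> l i = (\<lambda>x. a * g\<^sub>1 x + (b * g\<^sub>2 x + f x))" if "i \<in> I" for i
  proof -
    have "l i \<in> lin_span (g\<^sub>1 # g\<^sub>2 # G)" using l that by (simp add: G')
    then obtain a h where h: "h \<in> lin_span (g\<^sub>2 # G)" "l i = (\<lambda>x. a * g\<^sub>1 x + h x)"
      unfolding lin_span.simps(2)[of g\<^sub>1] by blast
    then obtain b f where "f \<in> lin_span G" "h = (\<lambda>x. b * g\<^sub>2 x + f x)"
      unfolding lin_span.simps by blast
    then show ?thesis using h(2) by blast
  qed
  then obtain a b f where abf: "\<And>i. i \<in> I \<Longrightarrow> f i \<in> lin_span G"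
    "\<And>i. i \<in> I \<Longrightarrow> l i = (\<lambda>x. a i * g\<^sub>1 x + (b i * g\<^sub>2 x + f i x))"
    by metis
  define Z where "Z = {i\<in>I. a i = 0}"
  define J where "J = {i\<in>I. a i \<noteq> 0}"
  have "I = Z \<union> J" by (auto simp: Z_def J_def)
  then have "card I \<le> card Z + card J" by (simp add: card_Un_le)
  then consider "card I \<le> 2 * card Z" | "card I \<le> 2 * card J" by linarith
  then show "\<exists>\<C>. sign_cover (K * K) (\<mu>\<^sup>2 / 8 * real (card I)) I l \<C>"
  proof cases
    case 1
    have span: "l i \<in> lin_span (g\<^sub>2 # G)" if "i \<in> Z" for i
      using that by (intro lin_span_ConsI[OF abf(1)]) (auto simp: Z_def abf(2))
    have "\<exists>\<C>. sign_cover K (\<mu> * real (card Z)) Z l \<C>"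
      by (rule covers_dimD[OF cov _ _ span]) (use G' I in \<open>simp_all add: Z_def\<close>)
    then obtain \<C> where \<C>: "sign_cover K (\<mu> * real (card Z)) Z l \<C>" ..
    \<comment> \<open>The old cover settles \<open>\<mu> * card Z\<close> forms, which is enough
      since \<open>\<mu> \<le> 1\<close>.\<close>
    have "\<mu>\<^sup>2 / 8 * real (card I) \<le> \<mu> / 2 * (2 * real (card Z))"
      using 1 \<mu> by (intro mult_mono) (auto simp: power2_eq_square mult_left_le)
    then have "sign_cover (K * K) (\<mu>\<^sup>2 / 8 * real (card I)) I l \<C>"
      using I by (intro sign_cover_mono[OF \<C>]) (auto simp: Z_def)
    then show ?thesis by blast
  next
    case 2
    have J: "finite J" using I by (simp add: J_def)
    define l' where "l' i = (\<lambda>x. inverse (a i) * l i x)" for i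
    have "\<exists>\<C>. sign_cover (K * K) (\<mu>\<^sup>2 / 4 * real (card J)) J l' \<C>"
    proof (rule sign_cover_pairing)
      show "covers_dim TYPE('i) TYPE('c) (Suc (length G)) K \<mu>" using cov G' by simp
      show "(\<lambda>x. inverse (a i) * f i x) \<in> lin_span G" if "i \<in> J" for i
        using abf that by (intro lin_span_scale) (auto simp: J_def)
      show "l' i x = g\<^sub>1 x + (inverse (a i) * b i) * g\<^sub>2 x + inverse (a i) * f i x"
        if "i \<in> J" for i x
        using that abf by (simp add: J_def l'_def algebra_simps)
    qed (use \<mu> J in auto)
    then obtain \<C> where \<C>: "sign_cover (K * K) (\<mu>\<^sup>2 / 4 * real (card J)) J l' \<C>" by blast
    have "{i\<in>J. const_sign \<sigma> (l' i)} = {i\<in>J. const_sign \<sigma> (l i)}" for \<sigma>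
      by (auto simp: J_def l'_def const_sign_mult_iff)
    then have \<C>': "sign_cover (K * K) (\<mu>\<^sup>2 / 4 * real (card J)) J l \<C>"
      using \<C> by (simp add: sign_cover_def)
    have "\<mu>\<^sup>2 / 8 * real (card I) \<le> \<mu>\<^sup>2 / 8 * (2 * real (card J))"
      using 2 by (intro mult_left_mono) auto
    then have "sign_cover (K * K) (\<mu>\<^sup>2 / 8 * real (card I)) I l \<C>"
      using I by (intro sign_cover_mono[OF \<C>']) (auto simp: J_def)
    then show ?thesis by blast
  qed
qed

text \<open>Induction on the dimension, starting at a single generator with three cells. Each step
  squares \<open>K\<close> and replaces \<open>\<mu>\<close> by \<open>\<mu>\<^sup>2 / 8\<close>, so
  both depend on the dimension alone.\<close>

lemma covers_dim_exists:
  "\<exists>K \<mu>. 0 < \<mu> \<and> \<mu> \<le> 1 \<and> covers_dim TYPE('i) TYPE('c) (Suc D) K \<mu>"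
proof (induction D)
  case 0
  have "covers_dim TYPE('i) TYPE('c) (Suc 0) 3 1"
    unfolding covers_dim_def
  proof (intro allI impI)
    fix G :: "('c \<Rightarrow> real) list" and I :: "'i set" and l
    assume "length G = Suc 0" "\<forall>i\<in>I. l i \<in> lin_span G"
    moreover from this obtain g where "G = [g]" by (auto simp: length_Suc_conv)
    ultimately show "\<exists>\<C>. sign_cover 3 (1 * real (card I)) I l \<C>"
      by (intro sign_cover_exists_one) simp
  qed
  then show ?case by (intro exI[of _ 3] exI[of _ 1]) auto
next
  case (Suc D)
  then obtain K \<mu> where K: "0 < \<mu>" "\<mu> \<le> 1" "covers_dim TYPE('i) TYPE('c) (Suc D) K \<mu>" by blast
  have "0 < \<mu>\<^sup>2 / 8" "\<mu>\<^sup>2 / 8 \<le> 1" using K power_le_one[of \<mu> 2] by auto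
  then show ?case using covers_dim_step[OF K(3,1,2)] by blast
qed

section \<open>Iterating the cover, and the number of rounds\<close>

text \<open>Each round applies the cover within a cell to the forms still undecided there. It
  multiplies the number of cells by at most \<open>K\<close> and the number of undecided forms by at
  most \<open>1 - \<mu>\<close>.\<close>

lemma iterated_cover:
  fixes I :: "'i set" and l :: "'i \<Rightarrow> 'c \<Rightarrow> real"
  assumes cov: "covers_dim TYPE('i) TYPE('c) D K \<mu>" and \<mu>: "0 < \<mu>" "\<mu> \<le> 1"
    and G: "length G = D" and I: "finite I" and l: "\<And>i. i \<in> I \<Longrightarrow> l i \<in> lin_span G"
  shows "\<exists>\<C>. finite \<C> \<and> card \<C> \<le> K ^ t \<and> \<Union>\<C> = UNIV \<and>
    (\<forall>\<sigma>\<in>\<C>. real (card {i\<in>I. \<not> const_sign \<sigma> (l i)}) \<le> (1 - \<mu>) ^ t * real (card I))"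
proof (induction t)
  case 0
  have "card {i\<in>I. \<not> const_sign UNIV (l i)} \<le> card I" using I by (intro card_mono) auto
  then show ?case by (intro exI[of _ "{UNIV}"]) auto
next
  case (Suc t)
  then obtain \<C> where \<C>: "finite \<C>" "card \<C> \<le> K ^ t" "\<Union>\<C> = UNIV"
    "\<And>\<sigma>. \<sigma> \<in> \<C> \<Longrightarrow> real (card {i\<in>I. \<not> const_sign \<sigma> (l i)}) \<le> (1 - \<mu>) ^ t * real (card I)"
    by blast
  have "\<exists>\<E>. finite \<E> \<and> card \<E> \<le> K ^ t * K \<and> \<Union>\<E> = UNIV \<and>
    (\<forall>\<rho>\<in>\<E>. real (card {i\<in>I. \<not> const_sign \<rho> (l i)}) \<le> (1 - \<mu>) ^ Suc t * real (card I))"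
  proof (rule refine_cover[OF \<C>(1-3)])
    fix \<sigma> assume \<sigma>: "\<sigma> \<in> \<C>"
    define J where "J = {i\<in>I. \<not> const_sign \<sigma> (l i)}"
    have J: "finite J" using I by (simp add: J_def)
    have "\<exists>\<D>. sign_cover K (\<mu> * real (card J)) J l \<D>"
      by (rule covers_dimD[OF cov G J l]) (simp add: J_def)
    then obtain \<D> where \<D>: "sign_cover K (\<mu> * real (card J)) J l \<D>" ..
    have "real (card {i\<in>I. \<not> const_sign (\<sigma> \<inter> \<tau>) (l i)}) \<le> (1 - \<mu>) ^ Suc t * real (card I)"
      if "\<tau> \<in> \<D>" for \<tau>
    proof -
      let ?R = "{i\<in>J. const_sign \<tau> (l i)}"
      \<comment> \<open>A form settled on \<open>\<sigma>\<close> or on \<open>\<tau>\<close> stays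
        settled on the intersection.\<close>
      have "{i\<in>I. \<not> const_sign (\<sigma> \<inter> \<tau>) (l i)} \<subseteq> J - ?R"
        using const_sign_subset[of _ _ "\<sigma> \<inter> \<tau>"] by (auto simp: J_def)
      then have "card {i\<in>I. \<not> const_sign (\<sigma> \<inter> \<tau>) (l i)} \<le> card (J - ?R)"
        using J by (intro card_mono) auto
      also have "real (card (J - ?R)) = real (card J) - real (card ?R)"
        using J by (subst card_Diff_subset) (auto simp: of_nat_diff card_mono)
      also have "\<dots> \<le> (1 - \<mu>) * real (card J)"
        using \<D> that by (auto simp: sign_cover_def algebra_simps)
      also have "\<dots> \<le> (1 - \<mu>) * ((1 - \<mu>) ^ t * real (card I))"
        using \<C>(4)[OF \<sigma>] \<mu> by (intro mult_left_mono) (auto simp: J_def)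
      finally show ?thesis by (simp add: algebra_simps)
    qed
    then show "\<exists>\<D>. finite \<D> \<and> card \<D> \<le> K \<and> \<Union>\<D> = UNIV \<and>
       (\<forall>\<tau>\<in>\<D>. real (card {i\<in>I. \<not> const_sign (\<sigma> \<inter> \<tau>) (l i)}) \<le> (1 - \<mu>) ^ Suc t * real (card I))"
      using \<D> unfolding sign_cover_def by blast
  qed
  then show ?case by (simp add: mult.commute)
qed

text \<open>Logarithmically many rounds bring the undecided fraction down to
  \<open>\<epsilon>\<close>, at a cost polynomial in \<open>1 / \<epsilon>\<close>. With
  \<open>K \<le> (1 / r) ^ E\<close> and \<open>t\<close> least such that
  \<open>r ^ t \<le> \<epsilon>\<close>, the first \<open>t - 1\<close> rounds cost at most
  \<open>(1 / \<epsilon>) ^ E\<close>; the last one costs another \<open>K\<close>.\<close>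

lemma geometric_scale:
  fixes K r :: real
  assumes r: "0 < r" "r < 1" and K: "1 \<le> K"
  shows "\<exists>E::nat. \<forall>\<epsilon>. 0 < \<epsilon> \<and> \<epsilon> < 1 \<longrightarrow> (\<exists>t. r ^ t \<le> \<epsilon> \<and> K ^ t \<le> K * (1 / \<epsilon>) ^ E)"
proof -
  obtain E where E: "r ^ E < 1 / K" using real_arch_pow_inv[of "1 / K" r] r K by auto
  then have KE: "K \<le> (1 / r) ^ E" using r K by (simp add: field_simps)
  have "\<exists>t. r ^ t \<le> \<epsilon> \<and> K ^ t \<le> K * (1 / \<epsilon>) ^ E" if \<epsilon>: "0 < \<epsilon>" "\<epsilon> < 1" for \<epsilon>
  proof -
    have ex: "\<exists>t. r ^ t \<le> \<epsilon>" using real_arch_pow_inv[OF \<epsilon>(1) r(2)] by (auto intro: less_imp_le)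
    define t where "t = (LEAST t. r ^ t \<le> \<epsilon>)"
    have t: "r ^ t \<le> \<epsilon>" unfolding t_def using ex by (rule LeastI_ex)
    \<comment> \<open>\<open>t = 0\<close> is impossible because \<open>r ^ 0 = 1\<close> exceeds
      \<open>\<epsilon>\<close>.\<close>
    then obtain k where k: "t = Suc k" using \<epsilon> by (cases t) auto
    then have "\<not> r ^ k \<le> \<epsilon>" using not_less_Least[of k "\<lambda>t. r ^ t \<le> \<epsilon>"] by (simp add: t_def)
    then have "(1 / r) ^ k \<le> 1 / \<epsilon>" using r \<epsilon> by (simp add: field_simps)
    then have "((1 / r) ^ k) ^ E \<le> (1 / \<epsilon>) ^ E" using r by (intro power_mono) auto
    moreover have "K ^ k \<le> ((1 / r) ^ E) ^ k" using KE K by (intro power_mono) auto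
    moreover have "((1 / r) ^ E) ^ k = ((1 / r) ^ k) ^ E" by (simp only: power_mult[symmetric] mult.commute)
    ultimately have "K ^ k \<le> (1 / \<epsilon>) ^ E" by linarith
    then have "K ^ t \<le> K * (1 / \<epsilon>) ^ E" using K k by simp
    then show ?thesis using t by blast
  qed
  then show ?thesis by blast
qed

section \<open>Brackets of polynomial size for semialgebraic classes\<close>

text \<open>\<open>C\<close> and \<open>E\<close> are fixed before \<open>X\<close> and
  \<open>\<epsilon>\<close>. Bracketing the trace of the whole class serves every system generated
  by it.\<close>

definition poly_brackets :: "'a set set \<Rightarrow> real \<Rightarrow> nat \<Rightarrow> bool" where
  "poly_brackets \<Gamma> C E \<longleftrightarrow> (\<forall>X \<epsilon>. finite X \<and> 0 < \<epsilon> \<and> \<epsilon> < 1 \<longrightarrow>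
     (\<exists>\<B>. is_bracket \<epsilon> X (trace_on \<Gamma> X) \<B> \<and> real (card \<B>) \<le> C * (1 / \<epsilon>) ^ E))"

text \<open>A cell \<open>\<sigma>\<close> of coefficient vectors gives the pair
  \<open>L \<sigma>\<close>, \<open>U \<sigma>\<close>: the points where all, respectively some, of
  its polynomials are nonnegative. The set of any polynomial with coefficients in
  \<open>\<sigma>\<close> lies between them, and the gap consists of points whose form is undecided
  on \<open>\<sigma>\<close>.\<close>

lemma poly_brackets_atoms:
  "\<exists>C E. poly_brackets {{x. f x \<ge> 0} | f :: real ^ 'd \<Rightarrow> real. polynomial_of_degree_le \<Delta> f} C E"
proof -
  define M where "M = {\<alpha> :: 'd \<Rightarrow> nat. (\<Sum>i\<in>UNIV. \<alpha> i) \<le> \<Delta>}"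
  have finM: "finite M" unfolding M_def by (rule finite_bounded_exponents)
  then obtain ks where ks: "set ks = M" "distinct ks" using finite_distinct_list by blast
  \<comment> \<open>The constant monomial makes the number of generators positive, as the cover
    lemma works in dimension \<open>Suc D\<close>.\<close>
  have "(\<lambda>_. 0) \<in> M" by (simp add: M_def)
  then have "length ks \<noteq> 0" using ks by auto
  then obtain D where D: "length ks = Suc D" by (cases "length ks") auto
  define F where "F x = (\<lambda>c :: ('d \<Rightarrow> nat) \<Rightarrow> real. \<Sum>\<alpha>\<in>M. c \<alpha> * (\<Prod>i\<in>UNIV. (x $ i) ^ \<alpha> i))"
    for x :: "real ^ 'd"
  define G where "G = map (\<lambda>\<alpha> (c :: ('d \<Rightarrow> nat) \<Rightarrow> real). c \<alpha>) ks"
  have FG: "F x \<in> lin_span G" for x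
  proof -
    have "F x = (\<lambda>c. \<Sum>\<alpha>\<leftarrow>ks. (\<Prod>i\<in>UNIV. (x $ i) ^ \<alpha> i) * c \<alpha>)"
      using ks by (simp add: F_def sum_list_distinct_conv_sum_set mult.commute)
    also have "\<dots> \<in> lin_span G" unfolding G_def by (rule sum_in_lin_span)
    finally show ?thesis .
  qed
  obtain K0 \<mu>0 where K0: "0 < \<mu>0" "\<mu>0 \<le> 1"
    "covers_dim TYPE(real ^ 'd) TYPE(('d \<Rightarrow> nat) \<Rightarrow> real) (Suc D) K0 \<mu>0"
    using covers_dim_exists by blast
  \<comment> \<open>The constants are weakened to suit \<open>geometric_scale\<close>: it needs
    \<open>1 \<le> K\<close> and \<open>0 < 1 - \<mu>\<close>, whereas \<open>\<mu>0\<close> may be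
    1.\<close>
  define K where "K = max 1 K0"
  define \<mu> where "\<mu> = \<mu>0 / 2"
  have cov: "covers_dim TYPE(real ^ 'd) TYPE(('d \<Rightarrow> nat) \<Rightarrow> real) (Suc D) K \<mu>"
    unfolding covers_dim_def
  proof (intro allI impI)
    fix G :: "((('d \<Rightarrow> nat) \<Rightarrow> real) \<Rightarrow> real) list" and I :: "(real ^ 'd) set" and l
    assume *: "length G = Suc D" "finite I" "\<forall>i\<in>I. l i \<in> lin_span G"
    then obtain \<C> where "sign_cover K0 (\<mu>0 * real (card I)) I l \<C>"
      using K0(3) unfolding covers_dim_def by blast
    then have "sign_cover K (\<mu> * real (card I)) I l \<C>"
      by (rule sign_cover_mono) (use * K0 in \<open>auto simp: K_def \<mu>_def intro: mult_right_mono\<close>)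
    then show "\<exists>\<C>. sign_cover K (\<mu> * real (card I)) I l \<C>" by blast
  qed
  have \<mu>: "0 < \<mu>" "\<mu> < 1" using K0 by (auto simp: \<mu>_def)
  obtain E where E: "\<And>\<epsilon>. 0 < \<epsilon> \<and> \<epsilon> < 1 \<Longrightarrow>
      \<exists>t. (1 - \<mu>) ^ t \<le> \<epsilon> \<and> real K ^ t \<le> real K * (1 / \<epsilon>) ^ E"
    using geometric_scale[of "1 - \<mu>" "real K"] \<mu> by (auto simp: K_def)
  have "poly_brackets {{x. f x \<ge> 0} | f :: real ^ 'd \<Rightarrow> real. polynomial_of_degree_le \<Delta> f}
      (2 * real K) E"
    unfolding poly_brackets_def
  proof (intro allI impI)
    fix X :: "(real ^ 'd) set" and \<epsilon> :: real
    assume asm: "finite X \<and> 0 < \<epsilon> \<and> \<epsilon> < 1"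
    then obtain t where t: "(1 - \<mu>) ^ t \<le> \<epsilon>" "real K ^ t \<le> real K * (1 / \<epsilon>) ^ E"
      using E by blast
    have "\<exists>\<C>. finite \<C> \<and> card \<C> \<le> K ^ t \<and> \<Union>\<C> = UNIV \<and>
      (\<forall>\<sigma>\<in>\<C>. real (card {x\<in>X. \<not> const_sign \<sigma> (F x)}) \<le> (1 - \<mu>) ^ t * real (card X))"
      by (rule iterated_cover[OF cov _ _ _ _ FG]) (use asm \<mu> D in \<open>simp_all add: G_def\<close>)
    then obtain \<C> where \<C>: "finite \<C>" "card \<C> \<le> K ^ t" "\<Union>\<C> = UNIV"
      "\<And>\<sigma>. \<sigma> \<in> \<C> \<Longrightarrow> real (card {x\<in>X. \<not> const_sign \<sigma> (F x)}) \<le> (1 - \<mu>) ^ t * real (card X)"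
      by blast
    define L where "L \<sigma> = {x\<in>X. \<forall>c\<in>\<sigma>. F x c \<ge> 0}" for \<sigma>
    define U where "U \<sigma> = {x\<in>X. \<exists>c\<in>\<sigma>. F x c \<ge> 0}" for \<sigma>
    have small: "real (card (U \<sigma> - L \<sigma>)) \<le> \<epsilon> * real (card X)" if "\<sigma> \<in> \<C>" for \<sigma>
    proof -
      \<comment> \<open>At a point of the gap, the form is nonnegative at one vector of
        \<open>\<sigma>\<close> and negative at another.\<close>
      have "U \<sigma> - L \<sigma> \<subseteq> {x\<in>X. \<not> const_sign \<sigma> (F x)}"
        using const_signD by (fastforce simp: U_def L_def)
      then have "card (U \<sigma> - L \<sigma>) \<le> card {x\<in>X. \<not> const_sign \<sigma> (F x)}"
        using asm by (intro card_mono) auto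
      also have "real \<dots> \<le> (1 - \<mu>) ^ t * real (card X)" using \<C>(4) that by blast
      also have "\<dots> \<le> \<epsilon> * real (card X)" using t by (intro mult_right_mono) auto
      finally show ?thesis by simp
    qed
    have "is_bracket \<epsilon> X (trace_on {{x. f x \<ge> 0} | f. polynomial_of_degree_le \<Delta> f} X)
        (L ` \<C> \<union> U ` \<C>)"
      unfolding is_bracket_def
    proof (intro conjI ballI)
      show "L ` \<C> \<union> U ` \<C> \<subseteq> Pow X" by (auto simp: L_def U_def)
      fix R assume "R \<in> trace_on {{x. f x \<ge> 0} | f. polynomial_of_degree_le \<Delta> f} X"
      then obtain f where f: "polynomial_of_degree_le \<Delta> f" "R = {x. f x \<ge> 0} \<inter> X"
        by (auto simp: trace_on_def)
      then obtain c where "\<forall>x. f x = F x c"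
        unfolding polynomial_of_degree_le_def F_def M_def by blast
      then have R: "R = {x\<in>X. F x c \<ge> 0}" using f by auto
      obtain \<sigma> where \<sigma>: "\<sigma> \<in> \<C>" "c \<in> \<sigma>" using UNIV_I[of c] \<C>(3) by (metis UnionE)
      then have "L \<sigma> \<subseteq> R" "R \<subseteq> U \<sigma>" by (auto simp: R L_def U_def)
      then show "\<exists>L'\<in>L ` \<C> \<union> U ` \<C>. \<exists>U'\<in>L ` \<C> \<union> U ` \<C>. L' \<subseteq> R \<and> R \<subseteq> U' \<and>
          real (card (U' - L')) \<le> \<epsilon> * real (card X)"
        by (intro bexI[of _ "L \<sigma>"] bexI[of _ "U \<sigma>"] conjI small \<sigma>(1)) (use \<sigma>(1) in simp_all)
    qed
    moreover have "real (card (L ` \<C> \<union> U ` \<C>)) \<le> 2 * real K * (1 / \<epsilon>) ^ E"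
    proof -
      have "card (L ` \<C> \<union> U ` \<C>) \<le> card (L ` \<C>) + card (U ` \<C>)" by (rule card_Un_le)
      also have "\<dots> \<le> 2 * K ^ t"
        using card_image_le[OF \<C>(1), of L] card_image_le[OF \<C>(1), of U] \<C>(2) by linarith
      finally have "real (card (L ` \<C> \<union> U ` \<C>)) \<le> 2 * real K ^ t"
        by (metis of_nat_le_iff of_nat_mult of_nat_numeral of_nat_power)
      then show ?thesis using t by linarith
    qed
    ultimately show "\<exists>\<B>. is_bracket \<epsilon> X
        (trace_on {{x. f x \<ge> 0} | f. polynomial_of_degree_le \<Delta> f} X) \<B> \<and>
        real (card \<B>) \<le> 2 * real K * (1 / \<epsilon>) ^ E" by blast
  qed
  then show ?thesis by blast
qed

text \<open>Brackets for \<open>\<epsilon> / 2\<close> are combined by the same operation as the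
  sets. The gap of the result lies in the union of the two old gaps, so it has at most
  \<open>\<epsilon> * card X\<close> points. From \<open>n\<close> brackets at most
  \<open>n + n\<^sup>2 + n\<^sup>2 + n \<le> 4 * n\<^sup>2\<close> arise, and halving
  \<open>\<epsilon>\<close> accounts for \<open>2 ^ E\<close>.\<close>

lemma poly_brackets_boolean_step:
  assumes \<Gamma>: "poly_brackets \<Gamma> C E"
    and \<Gamma>': "\<And>S. S \<in> \<Gamma>' \<Longrightarrow> S \<in> \<Gamma> \<or> (\<exists>A\<in>\<Gamma>. \<exists>B\<in>\<Gamma>. S = A \<union> B \<or> S = A \<inter> B \<or> S = - A)"
  shows "poly_brackets \<Gamma>' (4 * (C * 2 ^ E)\<^sup>2) (2 * E)"
  unfolding poly_brackets_def
proof (intro allI impI)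
  fix X \<epsilon>
  assume asm: "finite (X :: 'a set) \<and> 0 < (\<epsilon>::real) \<and> \<epsilon> < 1"
  then obtain \<B> where \<B>: "is_bracket (\<epsilon> / 2) X (trace_on \<Gamma> X) \<B>"
    "real (card \<B>) \<le> C * (1 / (\<epsilon> / 2)) ^ E"
    using \<Gamma> unfolding poly_brackets_def by (metis half_gt_zero field_sum_of_halves less_add_same_cancel1 order_less_trans)
  have sub: "\<B> \<subseteq> Pow X" using \<B> by (simp add: is_bracket_def)
  have finB: "finite \<B>" using sub asm by (meson finite_Pow_iff finite_subset)
  define \<B>' where "\<B>' = \<B> \<union> (\<lambda>(A, B). A \<union> B) ` (\<B> \<times> \<B>) \<union> (\<lambda>(A, B). A \<inter> B) ` (\<B> \<times> \<B>) \<union> (\<lambda>A. X - A) ` \<B>"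
  have inB': "A \<in> \<B>'" "A \<union> B \<in> \<B>'" "A \<inter> B \<in> \<B>'" "X - A \<in> \<B>'" if "A \<in> \<B>" "B \<in> \<B>" for A B
    using that by (auto simp: \<B>'_def)
  have br: "\<exists>L\<in>\<B>. \<exists>U\<in>\<B>. L \<subseteq> S \<inter> X \<and> S \<inter> X \<subseteq> U \<and> real (card (U - L)) \<le> \<epsilon> / 2 * real (card X)"
    if "S \<in> \<Gamma>" for S
    using \<B>(1) that unfolding is_bracket_def trace_on_def by blast
  have two: "real (card W) \<le> \<epsilon> * real (card X)"
    if "W \<subseteq> P \<union> Q" "finite P" "finite Q" "real (card P) \<le> \<epsilon> / 2 * real (card X)"
      "real (card Q) \<le> \<epsilon> / 2 * real (card X)" for W P Q :: "'a set"
  proof -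
    have "card W \<le> card P + card Q"
      using that by (meson card_Un_le card_mono finite_UnI le_trans)
    then have "real (card W) \<le> real (card P) + real (card Q)" by linarith
    then show ?thesis using that by linarith
  qed
  have "is_bracket \<epsilon> X (trace_on \<Gamma>' X) \<B>'"
    unfolding is_bracket_def
  proof (intro conjI ballI)
    show "\<B>' \<subseteq> Pow X" using sub by (auto simp: \<B>'_def)
    fix R assume "R \<in> trace_on \<Gamma>' X"
    then obtain S where S: "S \<in> \<Gamma>'" "R = S \<inter> X" by (auto simp: trace_on_def)
    \<comment> \<open>For \<open>S \<in> \<Gamma>\<close> one can take \<open>A = B = S\<close>, so
      that all four cases start from two bracketed sets.\<close>
    obtain A B where AB: "A \<in> \<Gamma>" "B \<in> \<Gamma>" "S = A \<or> S = A \<union> B \<or> S = A \<inter> B \<or> S = - A"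
      using \<Gamma>'[OF S(1)] by blast
    obtain L1 U1 where 1: "L1 \<in> \<B>" "U1 \<in> \<B>" "L1 \<subseteq> A \<inter> X" "A \<inter> X \<subseteq> U1"
      "real (card (U1 - L1)) \<le> \<epsilon> / 2 * real (card X)" using br[OF AB(1)] by blast
    obtain L2 U2 where 2: "L2 \<in> \<B>" "U2 \<in> \<B>" "L2 \<subseteq> B \<inter> X" "B \<inter> X \<subseteq> U2"
      "real (card (U2 - L2)) \<le> \<epsilon> / 2 * real (card X)" using br[OF AB(2)] by blast
    have fin: "finite (U1 - L1)" "finite (U2 - L2)"
      using 1 2 sub asm by (meson PowD finite_Diff finite_subset subsetD)+
    note two = two[OF _ fin 1(5) 2(5)]
    from AB(3) consider "S = A" | "S = A \<union> B" | "S = A \<inter> B" | "S = - A" by blast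
    then show "\<exists>L\<in>\<B>'. \<exists>U\<in>\<B>'. L \<subseteq> R \<and> R \<subseteq> U \<and> real (card (U - L)) \<le> \<epsilon> * real (card X)"
    proof cases
      case 1
      show ?thesis
        by (rule bexI[of _ L1], rule bexI[of _ U1], intro conjI two)
           (use \<open>L1 \<in> \<B>\<close> \<open>U1 \<in> \<B>\<close> \<open>L1 \<subseteq> A \<inter> X\<close> \<open>A \<inter> X \<subseteq> U1\<close> inB' S 1 in auto)
    next
      case c: 2
      show ?thesis
        by (rule bexI[of _ "L1 \<union> L2"], rule bexI[of _ "U1 \<union> U2"], intro conjI two)
           (use 1(1-4) 2(1-4) inB' S c in auto)
    next
      case 3
      show ?thesis
        by (rule bexI[of _ "L1 \<inter> L2"], rule bexI[of _ "U1 \<inter> U2"], intro conjI two)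
           (use 1(1-4) 2(1-4) inB' S 3 in auto)
    next
      \<comment> \<open>Complementation exchanges the roles of the lower and the upper set.\<close>
      case 4
      show ?thesis
        by (rule bexI[of _ "X - U1"], rule bexI[of _ "X - L1"], intro conjI two)
           (use 1(1-4) sub inB' S 4 in auto)
    qed
  qed
  moreover have "real (card \<B>') \<le> 4 * (C * 2 ^ E)\<^sup>2 * (1 / \<epsilon>) ^ (2 * E)"
  proof -
    let ?n = "card \<B>"
    have "card ((\<lambda>(A, B). A \<union> B) ` (\<B> \<times> \<B>)) \<le> ?n * ?n" "card ((\<lambda>(A, B). A \<inter> B) ` (\<B> \<times> \<B>)) \<le> ?n * ?n"
      using finB by (metis card_cartesian_product card_image_le finite_cartesian_product)+
    moreover have "card ((\<lambda>A. X - A) ` \<B>) \<le> ?n" using finB by (rule card_image_le)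
    moreover have "?n \<le> ?n * ?n" by simp
    moreover have "card \<B>' \<le> ?n + card ((\<lambda>(A, B). A \<union> B) ` (\<B> \<times> \<B>))
        + card ((\<lambda>(A, B). A \<inter> B) ` (\<B> \<times> \<B>)) + card ((\<lambda>A. X - A) ` \<B>)"
      unfolding \<B>'_def by (intro card_Un_le[THEN order_trans] add_right_mono order_refl)
    ultimately have "card \<B>' \<le> 4 * (?n * ?n)" by linarith
    then have "real (card \<B>') \<le> 4 * (real ?n)\<^sup>2"
      by (metis of_nat_le_iff of_nat_mult of_nat_numeral power2_eq_square)
    also have "\<dots> \<le> 4 * (C * (1 / (\<epsilon> / 2)) ^ E)\<^sup>2"
      using \<B>(2) by (intro mult_left_mono power_mono) auto
    also have "\<dots> = 4 * (C * 2 ^ E)\<^sup>2 * (1 / \<epsilon>) ^ (2 * E)"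
    proof -
      have "(1 / (\<epsilon> / 2)) ^ E = 2 ^ E * (1 / \<epsilon>) ^ E" by (simp add: power_divide)
      then show ?thesis by (simp only: power_mult_distrib mult.assoc power_mult[symmetric] mult.commute[of E 2])
    qed
    finally show ?thesis .
  qed
  ultimately show "\<exists>\<B>. is_bracket \<epsilon> X (trace_on \<Gamma>' X) \<B> \<and>
      real (card \<B>) \<le> 4 * (C * 2 ^ E)\<^sup>2 * (1 / \<epsilon>) ^ (2 * E)" by blast
qed

lemma semialgebraic_class_0:
  "semialgebraic_class \<Delta> 0 = {{x. f x \<ge> 0} | f :: real ^ 'd \<Rightarrow> real. polynomial_of_degree_le \<Delta> f}"
proof -
  have "num_ops \<phi> = 0 \<longleftrightarrow> (\<exists>f. \<phi> = Atom f)" for \<phi> :: "(real ^ 'd \<Rightarrow> real) bool_formula"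
    by (cases \<phi>) auto
  then have "(semialgebraic_class \<Delta> 0 :: (real ^ 'd) set set) =
      {defined_set \<phi> | \<phi>. (\<exists>f. \<phi> = Atom f) \<and> (\<forall>f\<in>atoms \<phi>. polynomial_of_degree_le \<Delta> f)}"
    by (simp add: semialgebraic_class_def)
  also have "\<dots> = {defined_set (Atom f) | f. \<forall>g\<in>atoms (Atom f). polynomial_of_degree_le \<Delta> g}"
    by blast
  finally show ?thesis by simp
qed

text \<open>Strip the outermost operation: it accounts for one of the \<open>Suc s\<close>
  operations, which leaves at most \<open>s\<close> for each argument.\<close>

lemma semialgebraic_class_Suc:
  assumes "S \<in> semialgebraic_class \<Delta> (Suc s)"
  shows "S \<in> semialgebraic_class \<Delta> s \<or> (\<exists>A\<in>semialgebraic_class \<Delta> s. \<exists>B\<in>semialgebraic_class \<Delta> s.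
    S = A \<union> B \<or> S = A \<inter> B \<or> S = - A)"
proof -
  obtain \<phi> where \<phi>: "S = defined_set \<phi>" "num_ops \<phi> \<le> Suc s"
    "\<forall>f\<in>atoms \<phi>. polynomial_of_degree_le \<Delta> f"
    using assms by (auto simp: semialgebraic_class_def)
  have mem: "defined_set \<theta> \<in> semialgebraic_class \<Delta> s"
    if "num_ops \<theta> \<le> s" "\<forall>f\<in>atoms \<theta>. polynomial_of_degree_le \<Delta> f" for \<theta>
    using that by (auto simp: semialgebraic_class_def)
  show ?thesis
  proof (cases \<phi>)
    case (Atom f)
    then show ?thesis using mem[of \<phi>] \<phi> by auto
  next
    case (Cup \<theta> \<theta>')
    then show ?thesis using mem[of \<theta>] mem[of \<theta>'] \<phi> by fastforce
  next
    case (Cap \<theta> \<theta>')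
    then show ?thesis using mem[of \<theta>] mem[of \<theta>'] \<phi> by fastforce
  next
    case (Cmpl \<theta>)
    then show ?thesis using mem[of \<theta>] \<phi> by fastforce
  qed
qed

text \<open>Induction on the number of operations. Each one doubles the exponent, so the size stays
  polynomial in \<open>1 / \<epsilon>\<close> for fixed \<open>s\<close>.\<close>

lemma poly_brackets_semialgebraic:
  "\<exists>C E. poly_brackets (semialgebraic_class \<Delta> s :: (real ^ 'd) set set) C E"
proof (induction s)
  case 0
  then show ?case using poly_brackets_atoms by (simp add: semialgebraic_class_0)
next
  case (Suc s)
  then obtain C E where "poly_brackets (semialgebraic_class \<Delta> s :: (real ^ 'd) set set) C E"
    by blast
  from poly_brackets_boolean_step[OF this semialgebraic_class_Suc] show ?case by blast
qed

section \<open>Comparison with the bound in terms of shallow cell complexities\<close>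

text \<open>A nonempty system has a nonempty trace on \<open>{y}\<close>, and all of its sets have
  size at most 1. The condition at \<open>Y = {y}\<close> and \<open>l = 1\<close> therefore forces
  \<open>1 \<le> \<psi> 1 1\<close>, which monotonicity carries to larger arguments.\<close>

lemma shallow_cell_complexity_ge_1:
  assumes scc: "shallow_cell_complexity X \<F> \<psi>" and mono: "nondecreasing \<psi>"
    and y: "y \<in> X" and "\<F> \<noteq> {}" and "1 \<le> m" "1 \<le> l"
  shows "1 \<le> \<psi> m l"
proof -
  obtain F where F: "F \<in> \<F>" using assms by blast
  have fin: "finite (trace_on \<F> {y})"
    by (rule finite_subset[of _ "Pow {y}"]) (auto simp: trace_on_def)
  have "card T \<le> 1" if "T \<in> trace_on \<F> {y}" for T
  proof -
    have "T \<subseteq> {y}" using that by (auto simp: trace_on_def)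
    then show ?thesis using card_mono[of "{y}" T] by simp
  qed
  then have "{T \<in> trace_on \<F> {y}. card T \<le> 1} = trace_on \<F> {y}" by auto
  moreover have "real (card {T \<in> trace_on \<F> {y}. card T \<le> 1})
      \<le> real (card {y}) * \<psi> (real (card {y})) (real 1)"
    using scc[unfolded shallow_cell_complexity_def, rule_format, of "{y}" 1] y by simp
  moreover have "F \<inter> {y} \<in> trace_on \<F> {y}" using F by (auto simp: trace_on_def)
  then have "card (trace_on \<F> {y}) \<noteq> 0" using fin by auto
  ultimately have "1 \<le> \<psi> 1 1" by simp
  also have "\<psi> 1 1 \<le> \<psi> m l" using mono assms by (simp add: nondecreasing_def)
  finally show ?thesis .
qed

theorem theorem4p8:
  fixes \<Delta> s :: nat
  assumes "\<Delta> \<ge> 1" and "s \<ge> 1"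
  shows "\<exists>\<Lambda> c\<^sub>0 :: real. 0 < \<Lambda> \<and> \<Lambda> < 1 \<and> 0 < c\<^sub>0 \<and>
    (\<forall>(X :: (real ^ 'd) set) \<R> (d\<^sub>0 :: nat) \<psi> \<psi>'.
       finite X \<and>
       generated_by X \<R> (semialgebraic_class \<Delta> s) \<and>
       has_vc_dimension X \<R> d\<^sub>0 \<and> d\<^sub>0 \<ge> 1 \<and>
       shallow_cell_complexity X \<R> \<psi> \<and> nondecreasing \<psi> \<and>
       shallow_cell_complexity X (complement_system X \<R>) \<psi>' \<and> nondecreasing \<psi>' \<longrightarrow>
       (\<forall>\<epsilon> :: real. 0 < \<epsilon> \<and> \<epsilon> < 1 \<longrightarrow>
          (\<exists>\<B>. is_bracket \<epsilon> X \<R> \<B> \<and>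
             real (card \<B>) \<le>
               (c\<^sub>0 * exp 1) ^ d\<^sub>0 *
               (8 / \<epsilon>) powr (1 + real d\<^sub>0 / ln (inverse (1 - \<Lambda> / 2))) *
               (96 * real d\<^sub>0 / \<epsilon>\<^sup>2) *
               (\<psi> (8 * real d\<^sub>0 / \<epsilon>\<^sup>2) (30 * real d\<^sub>0 / \<epsilon>) +
                \<psi>' (8 * real d\<^sub>0 / \<epsilon>\<^sup>2) (30 * real d\<^sub>0 / \<epsilon>)))))"
proof -
  obtain C E where CE: "poly_brackets (semialgebraic_class \<Delta> s :: (real ^ 'd) set set) C E"
    using poly_brackets_semialgebraic by blast
  \<comment> \<open>\<open>\<Lambda>\<close> is so small that
    \<open>1 / \<kappa> \<ge> 1 / \<Lambda> = E + 2\<close>, by \<open>ln x \<le> x - 1\<close>; the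
    summand 2 keeps \<open>\<Lambda>\<close> below 1 even for \<open>E = 0\<close>.\<close>
  define \<Lambda> :: real where "\<Lambda> = 1 / (real E + 2)"
  define c\<^sub>0 where "c\<^sub>0 = max 1 C"
  have \<Lambda>: "0 < \<Lambda>" "\<Lambda> < 1" by (auto simp: \<Lambda>_def)
  define \<kappa> where "\<kappa> = ln (inverse (1 - \<Lambda> / 2))"
  have \<kappa>: "0 < \<kappa>" using \<Lambda> by (simp add: \<kappa>_def one_less_inverse)
  have "\<kappa> \<le> inverse (1 - \<Lambda> / 2) - 1" unfolding \<kappa>_def using \<Lambda> by (intro ln_le_minus_one) auto
  also have "\<dots> \<le> \<Lambda>" using \<Lambda> by (simp add: field_simps)
  finally have \<kappa>_le: "real E \<le> 1 / \<kappa>"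
    using \<kappa> by (simp add: \<Lambda>_def field_simps)
  show ?thesis
  proof (rule exI[of _ \<Lambda>], rule exI[of _ c\<^sub>0], intro conjI allI impI; (elim conjE)?)
    show "0 < \<Lambda>" "\<Lambda> < 1" "0 < c\<^sub>0" using \<Lambda> by (auto simp: c\<^sub>0_def)
    fix X :: "(real ^ 'd) set" and \<R> and d\<^sub>0 :: nat and \<psi> \<psi>' and \<epsilon> :: real
    assume X: "finite X" and gen: "generated_by X \<R> (semialgebraic_class \<Delta> s)"
      and vc: "has_vc_dimension X \<R> d\<^sub>0" and d: "1 \<le> d\<^sub>0"
      and \<psi>: "shallow_cell_complexity X \<R> \<psi>" "nondecreasing \<psi>"
      and \<psi>': "shallow_cell_complexity X (complement_system X \<R>) \<psi>'" "nondecreasing \<psi>'"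
      and \<epsilon>: "0 < \<epsilon>" "\<epsilon> < 1"
    obtain \<B> where \<B>: "is_bracket \<epsilon> X (trace_on (semialgebraic_class \<Delta> s) X) \<B>"
      "real (card \<B>) \<le> C * (1 / \<epsilon>) ^ E"
      using CE X \<epsilon> unfolding poly_brackets_def by blast
    have "\<R> \<subseteq> trace_on (semialgebraic_class \<Delta> s) X"
      using gen by (auto simp: generated_by_def trace_on_def)
    then have bracket: "is_bracket \<epsilon> X \<R> \<B>" using \<B>(1) by (auto simp: is_bracket_def)
    \<comment> \<open>Positive VC dimension provides a shattered nonempty set, hence a point of
      \<open>X\<close> and a range in \<open>\<R>\<close>. Both are needed for the lower bounds on
      \<open>\<psi>\<close> and \<open>\<psi>'\<close>.\<close>
    obtain Y where Y: "Y \<subseteq> X" "shattered \<R> Y" "card Y = d\<^sub>0"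
      using vc by (auto simp: has_vc_dimension_def)
    then obtain y where y: "y \<in> X" using d by fastforce
    have ne: "\<R> \<noteq> {}" using Y by (auto simp: shattered_def trace_on_def)
    have ne': "complement_system X \<R> \<noteq> {}" using ne by (auto simp: complement_system_def)
    have \<epsilon>2: "\<epsilon>\<^sup>2 \<le> 1" using \<epsilon> by (simp add: power_le_one)
    have args: "1 \<le> 8 * real d\<^sub>0 / \<epsilon>\<^sup>2" "1 \<le> 30 * real d\<^sub>0 / \<epsilon>" "1 \<le> 96 * real d\<^sub>0 / \<epsilon>\<^sup>2"
      using d \<epsilon> \<epsilon>2 by (auto simp: field_simps)
    have sum: "1 \<le> \<psi> (8 * real d\<^sub>0 / \<epsilon>\<^sup>2) (30 * real d\<^sub>0 / \<epsilon>) +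
        \<psi>' (8 * real d\<^sub>0 / \<epsilon>\<^sup>2) (30 * real d\<^sub>0 / \<epsilon>)"
      using shallow_cell_complexity_ge_1[OF \<psi> y ne args(1,2)]
        shallow_cell_complexity_ge_1[OF \<psi>' y ne' args(1,2)] by linarith
    \<comment> \<open>As \<open>d\<^sub>0 \<ge> 1\<close> and the base is at least 1, a single
      factor \<open>c\<^sub>0\<close> absorbs \<open>C\<close>.\<close>
    have c1: "C \<le> (c\<^sub>0 * exp 1) ^ d\<^sub>0"
    proof -
      have "1 \<le> c\<^sub>0" "C \<le> c\<^sub>0" by (auto simp: c\<^sub>0_def)
      moreover from this have "c\<^sub>0 * 1 \<le> c\<^sub>0 * exp 1" by (intro mult_left_mono) auto
      ultimately have "C \<le> c\<^sub>0 * exp 1" "1 \<le> c\<^sub>0 * exp 1" by linarith+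
      then show ?thesis using self_le_power[of "c\<^sub>0 * exp 1" d\<^sub>0] d by linarith
    qed
    have pw: "(1 / \<epsilon>) ^ E \<le> (8 / \<epsilon>) powr (1 + real d\<^sub>0 / \<kappa>)"
    proof -
      have "(1 / \<epsilon>) ^ E \<le> (8 / \<epsilon>) ^ E" using \<epsilon> by (intro power_mono divide_right_mono) auto
      also have "\<dots> = (8 / \<epsilon>) powr real E" using \<epsilon> by (simp add: powr_realpow)
      also have "\<dots> \<le> (8 / \<epsilon>) powr (1 + real d\<^sub>0 / \<kappa>)"
      proof (rule powr_mono)
        \<comment> \<open>Again by \<open>d\<^sub>0 \<ge> 1\<close>, the exponent in the bound is at
          least \<open>1 / \<kappa>\<close> and thus at least \<open>E\<close>.\<close>
        have "1 / \<kappa> \<le> real d\<^sub>0 / \<kappa>" using \<kappa> d by (intro divide_right_mono) auto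
        then show "real E \<le> 1 + real d\<^sub>0 / \<kappa>" using \<kappa>_le by linarith
        show "1 \<le> 8 / \<epsilon>" using \<epsilon> by simp
      qed
      finally show ?thesis .
    qed
    let ?T = "(c\<^sub>0 * exp 1) ^ d\<^sub>0 * (8 / \<epsilon>) powr (1 + real d\<^sub>0 / \<kappa>)"
    have T: "0 \<le> ?T" by (simp add: c\<^sub>0_def)
    \<comment> \<open>The first two factors already bound the size of the bracket; the others are at
      least 1 and only enlarge the bound.\<close>
    have "C * (1 / \<epsilon>) ^ E \<le> ?T"
      using c1 pw \<epsilon> by (intro mult_mono) (auto simp: c\<^sub>0_def)
    also have "\<dots> \<le> ?T * (96 * real d\<^sub>0 / \<epsilon>\<^sup>2)"
      using mult_left_mono[OF args(3) T] by simp
    also have "\<dots> \<le> ?T * (96 * real d\<^sub>0 / \<epsilon>\<^sup>2) *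
        (\<psi> (8 * real d\<^sub>0 / \<epsilon>\<^sup>2) (30 * real d\<^sub>0 / \<epsilon>) + \<psi>' (8 * real d\<^sub>0 / \<epsilon>\<^sup>2) (30 * real d\<^sub>0 / \<epsilon>))"
      using mult_left_mono[OF sum, of "?T * (96 * real d\<^sub>0 / \<epsilon>\<^sup>2)"] T by simp
    finally have "real (card \<B>) \<le> ?T * (96 * real d\<^sub>0 / \<epsilon>\<^sup>2) *
        (\<psi> (8 * real d\<^sub>0 / \<epsilon>\<^sup>2) (30 * real d\<^sub>0 / \<epsilon>) + \<psi>' (8 * real d\<^sub>0 / \<epsilon>\<^sup>2) (30 * real d\<^sub>0 / \<epsilon>))"
      using \<B>(2) by linarith
    then show "\<exists>\<B>. is_bracket \<epsilon> X \<R> \<B> \<and> real (card \<B>) \<le>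
        (c\<^sub>0 * exp 1) ^ d\<^sub>0 * (8 / \<epsilon>) powr (1 + real d\<^sub>0 / ln (inverse (1 - \<Lambda> / 2))) *
        (96 * real d\<^sub>0 / \<epsilon>\<^sup>2) * (\<psi> (8 * real d\<^sub>0 / \<epsilon>\<^sup>2) (30 * real d\<^sub>0 / \<epsilon>) +
          \<psi>' (8 * real d\<^sub>0 / \<epsilon>\<^sup>2) (30 * real d\<^sub>0 / \<epsilon>))"
      using bracket unfolding \<kappa>_def by blast
  qed
qed

end
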